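(* Let $\mathbb{S}^1=\{z\in\mathbb{C} : |z|=1\}$ be the multiplicative group of complex numbers of modulus one. (a) Let $f:\mathbb{R}\to\mathbb{S}^1$ be $2\pi$-periodic. Then $f$ is a measurable homomorphism if and only if there exists $k\in\mathbb{Z}$ such that $f(x)=e^{ik\cdot x}$ for each $x\in\mathbb{R}$. (b) A function $f:\mathbb{R}\to\mathbb{S}^1$ is a measurable homomorphism if and only if there exists $\alpha\in\mathbb{R}$ such that $f(x)=e^{i\alpha\cdot x}$ for each $x\in\mathbb{R}$.
   Context: A homomorphism $f:\mathbb{R}\to\mathbb{S}^1$ is a group homomorphism from the additive group $\mathbb{R}$ to the multiplicative group $\mathbb{S}^1$, i.e. $f(x+y)=f(x)f(y)$ for all $x,y\in\mathbb{R}$. The function $f$ is $2\pi$-periodic if $f(x+2\pi)=f(x)$ for all $x\in\mathbb{R}$. Measurable means Lebesgue measurable; continuity of $f$ is not assumed. *)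

theory Defs
  imports "HOL-Analysis.Analysis"
begin

abbreviation unit_circle :: "complex set"
  where "unit_circle \<equiv> sphere 0 1"

text \<open>The codomain condition on maps into the circle is a separate hypothesis. Measurability is with
  respect to the Lebesgue (completed) sigma-algebra on the domain and the Borel one on the codomain.\<close>

definition homomorphism :: "(real \<Rightarrow> complex) \<Rightarrow> bool"
  where "homomorphism f \<longleftrightarrow> (\<forall>x y. f (x + y) = f x * f y)"

definition measurable_homomorphism :: "(real \<Rightarrow> complex) \<Rightarrow> bool"
  where "measurable_homomorphism f \<longleftrightarrow> f \<in> lebesgue \<rightarrow>\<^sub>M borel \<and> homomorphism f"

definition two_pi_periodic :: "(real \<Rightarrow> complex) \<Rightarrow> bool"
  where "two_pi_periodic f \<longleftrightarrow> (\<forall>x. f (x + 2 * pi) = f x)"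

end

theory Submission
  imports Defs
begin

text \<open>
  Integrating \<open>f (x + t) = f x * f t\<close> over \<open>t \<in> [0, c]\<close> expresses \<open>f x\<close> times the constant
  \<open>A = \<integral>\<^sub>0\<^sup>c f\<close> as \<open>\<integral>\<^sub>x\<^sup>x\<^sup>+\<^sup>c f\<close>. Some \<open>c\<close> makes \<open>A\<close> nonzero, since otherwise all interval integrals of \<open>f\<close>
  vanish and \<open>f = 0\<close> almost everywhere. The identity then shows first that \<open>f\<close> is continuous, and,
  used again, that \<open>f\<close> is differentiable, so \<open>f\<close> solves \<open>f' = f' 0 * f\<close>.
\<close>

text \<open>The measure with density \<open>1 + h\<close> gives every box its Lebesgue measure,
  hence is Lebesgue measure itself. Densities are unique almost everywhere, so \<open>1 + h\<close>
  equals \<open>1\<close> almost everywhere.\<close>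

lemma AE_zero_if_interval_integrals_zero:
  fixes h :: "real \<Rightarrow> real"
  assumes meas: "h \<in> borel_measurable lebesgue"
    and bdd: "\<And>x. \<bar>h x\<bar> \<le> 1"
    and zero: "\<And>l u. l \<le> u \<Longrightarrow> (h has_integral 0) {l..u}"
  shows "AE x in lborel. h x = 0"
proof -
  \<comment> \<open>A density with respect to \<open>lborel\<close> has to be Borel measurable,
    while \<open>h\<close> is only Lebesgue measurable; a Borel representative \<open>g\<close>
    takes its place.\<close>
  obtain g where g [measurable]: "g \<in> borel_measurable borel" and ae: "AE x in lborel. h x = g x"
    using completion_ex_borel_measurable_real[OF meas] by auto
  define M where "M = density lborel (\<lambda>x. ennreal (1 + g x))"
  \<comment> \<open>The shift by \<open>1\<close> makes the density nonnegative.\<close>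
  have "lborel = M"
  proof (rule lborel_eqI)
    fix l u :: real
    assume "\<And>b. b \<in> Basis \<Longrightarrow> l \<bullet> b \<le> u \<bullet> b"
    then have "l \<le> u" by simp
    have "((\<lambda>x. 1 + h x) has_integral (u - l) + 0) {l..u}"
      using has_integral_const_real[of "1::real" l u] \<open>l \<le> u\<close>
      by (intro has_integral_add zero) auto
    then have "((\<lambda>x. 1 + h x) has_integral (u - l)) (box l u)"
      using has_integral_Icc_iff_Ioo[of "\<lambda>x. 1 + h x" "u - l" l u] by (simp add: box_real)
    then have I: "(\<integral>\<^sup>+x. ennreal (1 + h x) * indicator (box l u) x \<partial>lborel) = ennreal (u - l)"
      by (rule nn_integral_has_integral_lebesgue'[rotated])
         (use bdd in \<open>smt (verit) abs_le_iff\<close>)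
    have "emeasure M (box l u) = (\<integral>\<^sup>+x. ennreal (1 + g x) * indicator (box l u) x \<partial>lborel)"
      unfolding M_def by (subst emeasure_density) auto
    also have "\<dots> = (\<integral>\<^sup>+x. ennreal (1 + h x) * indicator (box l u) x \<partial>lborel)"
      using ae by (intro nn_integral_cong_AE) auto
    finally show "emeasure M (box l u) = ennreal (\<Prod>b\<in>Basis. (u - l) \<bullet> b)"
      using I by simp
  qed (simp add: M_def)
  then have "density lborel (\<lambda>x. ennreal (1 + g x)) = density lborel (\<lambda>x. 1)"
    by (simp add: M_def density_1)
  then have "AE x in lborel. ennreal (1 + g x) = 1"
    by (intro sigma_finite_measure.density_unique[OF sigma_finite_lborel]) auto
  with ae show ?thesis
    by eventually_elim (use ennreal_eq_1 in auto)
qed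

text \<open>The homomorphism law turns vanishing integrals over intervals starting at
  \<open>0\<close> into vanishing integrals over all intervals. The real and imaginary parts are
  then zero almost everywhere, against \<open>norm (f x) = 1\<close>.\<close>

lemma circle_homomorphism_integral_nonzero:
  fixes f :: "real \<Rightarrow> complex"
  assumes meas: "f \<in> borel_measurable lebesgue"
    and norm: "\<And>x. norm (f x) = 1"
    and hom: "\<And>x y. f (x + y) = f x * f y"
    and int: "\<And>l u. f integrable_on {l..u}"
  obtains c where "c > 0" "integral {0..c} f \<noteq> 0"
proof -
  have "\<exists>c>0. integral {0..c} f \<noteq> 0"
  proof (rule ccontr)
    assume "\<not> ?thesis"
    then have *: "integral {0..c} f = 0" if "c \<ge> 0" for c
      using that by (cases "c = 0") auto
    have f0: "(f has_integral 0) {l..u}" if "l \<le> u" for l u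
    proof -
      have "(f has_integral 0) {0..u - l}"
        using * that int by (metis diff_ge_0_iff_ge integrable_integral)
      \<comment> \<open>Multiplication by \<open>f l\<close> acts on \<open>f\<close> as translation
        by \<open>l\<close>, so the zero integral moves from \<open>{0..u - l}\<close> to
        \<open>{l..u}\<close>.\<close>
      then have "((\<lambda>t. f l * f t) has_integral f l * 0) {0..u - l}"
        by (rule has_integral_mult_right)
      then have "(f \<circ> (+) l has_integral 0) {0..u - l}"
        by (simp add: o_def hom)
      then show ?thesis
        using has_integral_shift_Icc_real[of f l 0 0 "u - l"] by simp
    qed
    have "AE x in lborel. Re (f x) = 0"
    proof (rule AE_zero_if_interval_integrals_zero)
      show "\<bar>Re (f x)\<bar> \<le> 1" for x using abs_Re_le_cmod[of "f x"] norm by simp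
      show "((\<lambda>x. Re (f x)) has_integral 0) {l..u}" if "l \<le> u" for l u
        using has_integral_Re[OF f0[OF that]] by simp
    qed (use meas in measurable)
    moreover have "AE x in lborel. Im (f x) = 0"
    proof (rule AE_zero_if_interval_integrals_zero)
      show "\<bar>Im (f x)\<bar> \<le> 1" for x using abs_Im_le_cmod[of "f x"] norm by simp
      show "((\<lambda>x. Im (f x)) has_integral 0) {l..u}" if "l \<le> u" for l u
        using has_integral_Im[OF f0[OF that]] by simp
    qed (use meas in measurable)
    ultimately have "AE x in (lborel :: real measure). False"
      by eventually_elim (metis complex_eq_iff norm norm_zero zero_complex.sel zero_neq_one)
    then show False
      by (simp add: eventually_False trivial_limit_def[symmetric] ae_filter_eq_bot_iff)
  qed
  then show ?thesis using that by auto
qed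

lemma has_vector_derivative_shift:
  assumes "(f has_vector_derivative D) (at (x + c))"
  shows "((\<lambda>y. f (y + c)) has_vector_derivative D) (at x)"
proof -
  have "((\<lambda>y. y + c) has_vector_derivative 1) (at x)"
    by (auto intro!: derivative_eq_intros)
  from vector_diff_chain_at[OF this assms] show ?thesis
    by (simp add: o_def)
qed

text \<open>Regularity has to be shown at \<open>0\<close> only:
  \<open>f y = f x * f (y - x)\<close> carries continuity and differentiability from
  \<open>0\<close> to every \<open>x\<close>.\<close>

lemma measurable_circle_homomorphism_imp_exp:
  fixes f :: "real \<Rightarrow> complex"
  assumes meas: "f \<in> borel_measurable lebesgue"
    and norm: "\<And>x. norm (f x) = 1"
    and hom: "\<And>x y. f (x + y) = f x * f y"
  obtains \<alpha> :: real where "\<And>x. f x = exp (\<i> * of_real \<alpha> * of_real x)"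
proof -
  have int: "f integrable_on {l..u}" for l u
    by (rule measurable_bounded_by_integrable_imp_integrable[where g = "\<lambda>_. 1"])
       (use meas norm in \<open>auto intro: measurable_restrict_space1\<close>)
  obtain c where c: "c > 0" and A: "integral {0..c} f \<noteq> 0"
    using circle_homomorphism_integral_nonzero[OF meas norm hom int] .
  define A where "A = integral {0..c} f"
  \<comment> \<open>The base point \<open>-1\<close> puts \<open>0\<close> in the interior of the
    domain where \<open>G\<close> is used, so that the continuity and the derivative obtained at
    \<open>0\<close> are two-sided.\<close>
  define G where "G u = integral {-1..u} f" for u
  have f_eq: "f x = (G (x + c) - G x) / A" if "x \<ge> -1" for x
  proof -
    have "f x * A = integral {0..c} (f \<circ> (+) x)"
      by (simp add: A_def o_def hom)
    also have "\<dots> = integral {x..x + c} f"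
      by (simp add: integral_shift_Icc_real add.commute)
    also have "\<dots> = G (x + c) - G x"
      unfolding G_def using Henstock_Kurzweil_Integration.integral_combine[of "-1" x "x + c", OF _ _ int] that c
      by (simp add: algebra_simps)
    finally show ?thesis using A by (simp add: A_def field_simps)
  qed
  have near0: "\<forall>\<^sub>F x in nhds 0. f x = (G (x + c) - G x) / A"
    using eventually_nhds_in_open[of "{-1<..}" "0::real"]
    by (auto elim!: eventually_mono intro: f_eq)
  have "f 0 = 1"
    using hom[of 0 0] norm[of 0] by auto
  have contG: "isCont G x" if "x > -1" for x
  proof -
    have "continuous_on {-1..x + 1} G"
      unfolding G_def by (rule indefinite_integral_continuous_1[OF int])
    then show ?thesis
      using that by (intro continuous_on_interior[of "{-1..x + 1}"]) auto
  qed
  have "isCont (\<lambda>x. G (x + c)) 0"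
    by (rule isCont_o2[where g = G]) (use c in \<open>auto intro: contG\<close>)
  then have "isCont (\<lambda>x. (G (x + c) - G x) / A) 0"
    using A by (intro continuous_divide continuous_diff continuous_const contG) (auto simp: A_def)
  then have cont0: "isCont f 0"
    using isCont_cong[OF near0] by simp
  have contf: "isCont f x" for x
  proof -
    have "isCont (\<lambda>y. f (y - x)) x"
      by (rule isCont_o2[where g = f]) (use cont0 in auto)
    then have "isCont (\<lambda>y. f x * f (y - x)) x"
      by (intro continuous_mult continuous_const)
    then show ?thesis by (simp flip: hom)
  qed
  \<comment> \<open>The fundamental theorem of calculus applies now that \<open>f\<close> is known
    to be continuous.\<close>
  have derG: "(G has_vector_derivative f x) (at x)" if "x > -1" for x
  proof -
    have "(G has_vector_derivative f x) (at x within {-1..x + 1})"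
      unfolding G_def using that contf
      by (intro integral_has_vector_derivative continuous_at_imp_continuous_on) auto
    moreover have "at x within {-1..x + 1} = at x"
      using that by (intro at_within_interior) auto
    ultimately show ?thesis by simp
  qed
  \<comment> \<open>This is the derivative at \<open>0\<close> of the quotient in
    \<open>f_eq\<close>, since \<open>G\<close> has derivative \<open>f c\<close> at
    \<open>c\<close> and \<open>f 0\<close> at \<open>0\<close>.\<close>
  define D where "D = (f c - f 0) / A"
  have "((\<lambda>x. G (x + c)) has_vector_derivative f c) (at 0)"
    using derG[of c] c by (intro has_vector_derivative_shift) auto
  then have "((\<lambda>x. (G (x + c) - G x) / A) has_vector_derivative D) (at 0)"
    unfolding D_def by (intro has_vector_derivative_divide has_vector_derivative_diff derG) auto
  then have der0: "(f has_vector_derivative D) (at 0)"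
    by (rule has_vector_derivative_transform_within_open[of _ _ _ "{-1<..}"])
       (auto simp: f_eq)
  have der: "(f has_vector_derivative f x * D) (at x)" for x
  proof -
    have "((\<lambda>y. f (y - x)) has_vector_derivative D) (at x)"
      using has_vector_derivative_shift[of f D x "- x"] der0 by simp
    then have "((\<lambda>y. f x * f (y - x)) has_vector_derivative f x * D) (at x)"
      by (rule has_vector_derivative_mult_right)
    then show ?thesis by (simp flip: hom)
  qed
  have derE: "((\<lambda>y. exp (- D * of_real y)) has_vector_derivative - D * exp (- D * of_real x)) (at x)"
    for x :: real
    by (rule has_vector_derivative_real_field) (auto intro!: derivative_eq_intros)
  \<comment> \<open>The integrating factor \<open>exp (- D * x)\<close> solves
    \<open>f' = f * D\<close>: the product has derivative zero, so it keeps its value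
    \<open>1\<close> from \<open>x = 0\<close>.\<close>
  have "((\<lambda>y. f y * exp (- D * of_real y)) has_vector_derivative 0) (at x)" for x
    using has_vector_derivative_mult[OF der derE, of x] by (simp add: algebra_simps)
  then obtain k where k: "\<And>x. f x * exp (- D * of_real x) = k"
    using has_vector_derivative_zero_constant[of UNIV "\<lambda>y. f y * exp (- D * of_real y)"] by auto
  have "k = 1"
    using k[of 0] \<open>f 0 = 1\<close> by simp
  then have exp: "f x = exp (D * of_real x)" for x
    using k[of x] by (simp add: exp_minus field_simps)
  \<comment> \<open>At \<open>x = 1\<close> the modulus of \<open>exp D\<close> is
    \<open>exp (Re D)\<close>, which must be \<open>1\<close>.\<close>
  have "Re D = 0"
    using norm[of 1] exp[of 1] by simp
  then have "D = \<i> * of_real (Im D)"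
    by (simp add: complex_eq_iff)
  with exp that show ?thesis by metis
qed

lemma measurable_homomorphism_iff_exp:
  assumes "f \<in> UNIV \<rightarrow> unit_circle"
  shows "measurable_homomorphism f \<longleftrightarrow>
    (\<exists>\<alpha>::real. \<forall>x::real. f x = exp (\<i> * of_real \<alpha> * of_real x))"
proof
  assume "measurable_homomorphism f"
  then show "\<exists>\<alpha>::real. \<forall>x::real. f x = exp (\<i> * of_real \<alpha> * of_real x)"
    unfolding measurable_homomorphism_def homomorphism_def
    using measurable_circle_homomorphism_imp_exp[of f] assms by (simp add: Pi_iff) metis
next
  assume "\<exists>\<alpha>::real. \<forall>x::real. f x = exp (\<i> * of_real \<alpha> * of_real x)"
  then obtain \<alpha> :: real where f: "f = (\<lambda>x. exp (\<i> * of_real \<alpha> * of_real x))"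
    by auto
  have "continuous_on UNIV f"
    unfolding f by (intro continuous_intros)
  then have "f \<in> borel_measurable lebesgue"
    by (intro measurable_completion) (simp add: borel_measurable_continuous_onI)
  moreover have "homomorphism f"
    by (simp add: homomorphism_def f ring_distribs exp_add)
  ultimately show "measurable_homomorphism f"
    by (simp add: measurable_homomorphism_def)
qed

theorem theorem1:
  shows "(\<forall>f \<in> UNIV \<rightarrow> unit_circle. two_pi_periodic f \<longrightarrow>
            (measurable_homomorphism f \<longleftrightarrow>
              (\<exists>k::int. \<forall>x::real. f x = exp (\<i> * of_int k * of_real x)))) \<and>
         (\<forall>f \<in> UNIV \<rightarrow> unit_circle.
            measurable_homomorphism f \<longleftrightarrow>
              (\<exists>\<alpha>::real. \<forall>x::real. f x = exp (\<i> * of_real \<alpha> * of_real x)))"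
proof (intro conjI ballI impI)
  fix f :: "real \<Rightarrow> complex"
  assume f: "f \<in> UNIV \<rightarrow> unit_circle" and per: "two_pi_periodic f"
  show "measurable_homomorphism f \<longleftrightarrow>
    (\<exists>k::int. \<forall>x::real. f x = exp (\<i> * of_int k * of_real x))"
    unfolding measurable_homomorphism_iff_exp[OF f]
  proof
    assume "\<exists>\<alpha>::real. \<forall>x::real. f x = exp (\<i> * of_real \<alpha> * of_real x)"
    then obtain \<alpha> :: real where \<alpha>: "\<And>x. f x = exp (\<i> * of_real \<alpha> * of_real x)"
      by auto
    \<comment> \<open>One instance of periodicity is enough: \<open>exp\<close> equals
      \<open>1\<close> only at integer multiples of \<open>2 * pi * \<i>\<close>, which makes
      \<alpha> an integer.\<close>
    have "f (2 * pi) = f 0"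
      using per unfolding two_pi_periodic_def by (metis add_0)
    then have "exp (\<i> * of_real \<alpha> * of_real (2 * pi)) = 1"
      using \<alpha> by simp
    then obtain n :: int where "\<alpha> * (2 * pi) = of_int (2 * n) * pi"
      unfolding exp_eq_1 by auto
    then have "\<alpha> = of_int n" by simp
    then show "\<exists>k::int. \<forall>x::real. f x = exp (\<i> * of_int k * of_real x)"
      using \<alpha> by auto
  next
    assume "\<exists>k::int. \<forall>x::real. f x = exp (\<i> * of_int k * of_real x)"
    then show "\<exists>\<alpha>::real. \<forall>x::real. f x = exp (\<i> * of_real \<alpha> * of_real x)"
      by (metis of_real_of_int_eq)
  qed
qed (rule measurable_homomorphism_iff_exp)

end
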